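(* If the weak $3x+1$ conjecture holds, then the wild numbers conjecture is true; that is, the wild integer semigroup $\mathcal{W}(\mathbb{Z})$ consists exactly of all positive integers not divisible by $3$, equivalently the wild numbers are exactly the prime numbers other than $3$.
   Context: For integers $n\ge 0$ let $g(n)=\frac{3n+2}{2n+1}$. The wild semigroup $\mathcal{W}$ is the multiplicative semigroup of positive rationals generated by $\{g(n): n\ge 0\}$ together with $\frac12$ (all finite products, repetitions allowed). The wild integer semigroup is $\mathcal{W}(\mathbb{Z})=\mathcal{W}\cap\mathbb{Z}$; the wild numbers are its irreducible elements (elements not expressible as a product of two nonunits of $\mathcal{W}(\mathbb{Z})$). The weak $3x+1$ conjecture is the assertion that the semigroup $\mathcal{W}^{-1}=\{w^{-1}: w\in\mathcal{W}\}$ (generated by $\{\frac{2n+1}{3n+2}: n\ge 0\}$ together with $2$) contains every positive integer. *)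

theory Defs
  imports Complex_Main "HOL-Computational_Algebra.Primes"
begin

inductive_set generated_semigroup :: "'a::semigroup_mult set \<Rightarrow> 'a set" for G :: "'a set" where
  generator: "x \<in> G \<Longrightarrow> x \<in> generated_semigroup G"
| mult: "x \<in> generated_semigroup G \<Longrightarrow> y \<in> generated_semigroup G \<Longrightarrow> x * y \<in> generated_semigroup G"

definition units_in :: "'a::comm_monoid_mult set \<Rightarrow> 'a set" where
  "units_in S = {u \<in> S. \<exists>v\<in>S. u * v = 1}"

definition irreducibles_in :: "'a::comm_monoid_mult set \<Rightarrow> 'a set" where
  "irreducibles_in S = {x \<in> S - units_in S.
     \<not> (\<exists>a \<in> S - units_in S. \<exists>b \<in> S - units_in S. x = a * b)}"

definition g :: "nat \<Rightarrow> rat" where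
  "g n = (3 * of_nat n + 2) / (2 * of_nat n + 1)"

definition wild_semigroup :: "rat set" where
  "wild_semigroup = generated_semigroup (range g \<union> {1 / 2})"

definition wild_integer_semigroup :: "rat set" where
  "wild_integer_semigroup = wild_semigroup \<inter> \<int>"

definition wild_numbers :: "rat set" where
  "wild_numbers = irreducibles_in wild_integer_semigroup"

definition weak_3x_plus_1_conjecture :: bool where
  "weak_3x_plus_1_conjecture \<longleftrightarrow> (\<forall>m::nat. m > 0 \<longrightarrow> of_nat m \<in> inverse ` wild_semigroup)"

text \<open>Since \<open>g 0 * (1 / 2) = 1\<close>, it makes no difference whether the empty product is
  admitted in the wild semigroup.\<close>

lemma one_in_wild_semigroup: "1 \<in> wild_semigroup"
proof -
  have "g 0 * (1 / 2) \<in> wild_semigroup"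
    unfolding wild_semigroup_def by (intro generated_semigroup.intros) auto
  then show ?thesis by (simp add: g_def)
qed

lemma inverse_generated_semigroup:
  fixes G :: "'a::field set"
  shows "inverse ` generated_semigroup G = generated_semigroup (inverse ` G)"
proof (intro equalityI subsetI)
  fix x assume "x \<in> inverse ` generated_semigroup G"
  then obtain y where y: "y \<in> generated_semigroup G" and x: "x = inverse y" by blast
  from y show "x \<in> generated_semigroup (inverse ` G)" unfolding x
  proof induction
    case (generator y)
    then show ?case by (intro generated_semigroup.generator imageI)
  next
    case (mult y z)
    then show ?case unfolding inverse_mult_distrib by (intro generated_semigroup.mult)
  qed
next
  fix x assume "x \<in> generated_semigroup (inverse ` G)"
  then show "x \<in> inverse ` generated_semigroup G"
  proof induction
    case (generator x)
    then obtain y where "y \<in> G" "x = inverse y" by blast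
    then show ?case using generated_semigroup.generator by blast
  next
    case (mult x y)
    then obtain u v where "u \<in> generated_semigroup G" "x = inverse u"
      "v \<in> generated_semigroup G" "y = inverse v" by blast
    then show ?case
      using generated_semigroup.mult[of u G v] inverse_mult_distrib[of u v] by (metis imageI)
  qed
qed

lemma inverse_wild_semigroup:
  "inverse ` wild_semigroup =
     generated_semigroup (range (\<lambda>n. (2 * of_nat n + 1) / (3 * of_nat n + 2)) \<union> {2})"
  by (simp add: wild_semigroup_def inverse_generated_semigroup image_image g_def)

end

theory Submission
  imports Defs "HOL-Number_Theory.Residues"
begin

text \<open>
  Numerators of elements of \<open>\<W>\<close> are prime to \<open>3\<close>, so it remains to put every prime \<open>p \<noteq> 3\<close>
  into \<open>\<W>\<close>. Given the weak conjecture, the integers in \<open>\<W>\<close> are closed under divisors, and since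
  \<open>g n = (3 N + 1) / (2 N)\<close> for \<open>N = 2 n + 1\<close>, every divisor of \<open>3 N + 1\<close> lies in \<open>\<W>\<close> whenever an
  odd \<open>N\<close> does. For \<open>p \<ge> 13\<close> argue by induction: \<open>p - 12\<close> and \<open>p - 6\<close> are odd, prime to \<open>3\<close>
  and smaller than \<open>p\<close>, and modulo \<open>p\<close> we have \<open>(p - 12) / (p - 6)\<^sup>2 \<equiv> - 1 / 3\<close>. Replacing the
  division by a power (Fermat) yields an odd \<open>N\<close> in \<open>\<W>\<close> with \<open>p\<close> dividing \<open>3 N + 1\<close>. The primes
  \<open>2, 5, 7, 11\<close> are treated by explicit products.
\<close>

section \<open>Elements obtained without the conjecture\<close>

lemma g_in_wild_semigroup: "g n \<in> wild_semigroup"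
  unfolding wild_semigroup_def by (intro generated_semigroup.generator) simp

lemma half_in_wild_semigroup: "1 / 2 \<in> wild_semigroup"
  unfolding wild_semigroup_def by (intro generated_semigroup.generator) simp

lemma wild_semigroup_mult:
  "x \<in> wild_semigroup \<Longrightarrow> y \<in> wild_semigroup \<Longrightarrow> x * y \<in> wild_semigroup"
  unfolding wild_semigroup_def by (rule generated_semigroup.mult)

lemma wild_semigroup_power: "x \<in> wild_semigroup \<Longrightarrow> x ^ n \<in> wild_semigroup"
  by (induction n) (simp_all add: one_in_wild_semigroup wild_semigroup_mult)

lemma two_in_wild_semigroup: "2 \<in> wild_semigroup"
  using g_in_wild_semigroup[of 0] by (simp add: g_def)

text \<open>Found by linear programming over the exponents of the generators.\<close>

lemma five_in_wild_semigroup: "5 \<in> wild_semigroup"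
proof -
  have "g 3 ^ 7 * g 5 * g 32 ^ 3 * g 60 ^ 3 * g 416 * (1 / 2) ^ 7 \<in> wild_semigroup"
    by (intro wild_semigroup_mult wild_semigroup_power g_in_wild_semigroup half_in_wild_semigroup)
  also have "g 3 ^ 7 * g 5 * g 32 ^ 3 * g 60 ^ 3 * g 416 * (1 / 2) ^ 7 = 5"
    by (simp add: g_def power_divide)
  finally show ?thesis .
qed

section \<open>Divisibility by 3 and reduction to primes\<close>

text \<open>Every generator has numerator \<open>1\<close> or \<open>3 * n + 2\<close>, and 3 is
  prime, so products keep the numerator prime to 3. The fraction need not be in lowest terms, which
  spares any cancellation.\<close>

lemma wild_semigroup_fraction:
  assumes "w \<in> wild_semigroup"
  shows "\<exists>a b::nat. b > 0 \<and> \<not> 3 dvd a \<and> w = of_nat a / of_nat b"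
  using assms unfolding wild_semigroup_def
proof induction
  case (generator x)
  then consider n where "x = g n" | "x = 1 / 2" by blast
  then show ?case
  proof cases
    case 1
    have "\<not> 3 dvd 3 * n + 2" by presburger
    moreover have "x = of_nat (3 * n + 2) / of_nat (2 * n + 1)"
      by (simp add: 1 g_def add.commute)
    ultimately show ?thesis by (intro exI[of _ "3 * n + 2"] exI[of _ "2 * n + 1"]) simp
  next
    case 2
    then have "x = of_nat 1 / of_nat 2 \<and> \<not> 3 dvd (1::nat) \<and> (2::nat) > 0" by simp
    then show ?thesis by blast
  qed
next
  case (mult x y)
  then obtain a b c d :: nat where
    "b > 0" "\<not> 3 dvd a" "x = of_nat a / of_nat b"
    "d > 0" "\<not> 3 dvd c" "y = of_nat c / of_nat d" by blast
  moreover have "prime (3::nat)" by simp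
  ultimately have "b * d > 0 \<and> \<not> 3 dvd a * c \<and> x * y = of_nat (a * c) / of_nat (b * d)"
    by (simp add: prime_dvd_mult_iff)
  then show ?case by blast
qed

lemma wild_integer_semigroup_subset:
  "wild_integer_semigroup \<subseteq> {of_nat m | m::nat. m > 0 \<and> \<not> 3 dvd m}"
proof
  fix x assume "x \<in> wild_integer_semigroup"
  then have "x \<in> wild_semigroup" and "x \<in> \<int>" by (simp_all add: wild_integer_semigroup_def)
  then obtain a b :: nat where ab: "b > 0" "\<not> 3 dvd a" "x = of_nat a / of_nat b"
    using wild_semigroup_fraction by blast
  then have "x \<ge> 0" by simp
  with \<open>x \<in> \<int>\<close> obtain m where m: "x = of_nat m"
    by (metis Ints_cases of_int_0_le_iff of_int_of_nat_eq zero_le_imp_eq_int)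
  with ab have "(of_nat (m * b) :: rat) = of_nat a" by simp
  then have "m * b = a" by (simp only: of_nat_eq_iff)
  with ab have "\<not> 3 dvd m" by auto
  \<comment> \<open>Positivity comes for free, since 3 divides 0.\<close>
  moreover from this have "m > 0" by (auto intro: Nat.gr0I)
  ultimately show "x \<in> {of_nat m | m::nat. m > 0 \<and> \<not> 3 dvd m}" using m by blast
qed

lemma of_nat_in_wild_integer_semigroup_iff:
  "of_nat m \<in> wild_integer_semigroup \<longleftrightarrow> of_nat m \<in> wild_semigroup"
  by (simp add: wild_integer_semigroup_def)

text \<open>Prime factors are split off one at a time. Only primes up to \<open>m\<close> are
  assumed, so that the lemma can be applied inside a strong induction on primes.\<close>

lemma wild_semigroup_of_primes:
  assumes primes: "\<And>p::nat. prime p \<Longrightarrow> p \<noteq> 3 \<Longrightarrow> p \<le> m \<Longrightarrow> of_nat p \<in> wild_semigroup"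
    and "m > 0" "\<not> 3 dvd m"
  shows "of_nat m \<in> wild_semigroup"
  using assms
proof (induction m rule: less_induct)
  case (less m)
  show ?case
  proof (cases "m = 1")
    case True
    then show ?thesis by (simp add: one_in_wild_semigroup)
  next
    case False
    then obtain p where p: "prime p" "p dvd m" using prime_factor_nat by blast
    then obtain k where k: "m = p * k" by blast
    have "p \<noteq> 3" "p \<le> m" using p less.prems by (auto intro: dvd_imp_le)
    then have "of_nat p \<in> wild_semigroup" using p(1) less.prems(1) by blast
    moreover have "k > 0" "\<not> 3 dvd k" using less.prems(2,3) k by (auto intro: Nat.gr0I)
    moreover have "k < m" using k \<open>k > 0\<close> prime_gt_1_nat[OF p(1)] by simp
    ultimately have "of_nat p * of_nat k \<in> wild_semigroup"
      using less.IH[of k] less.prems(1) by (intro wild_semigroup_mult) auto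
    then show ?thesis by (simp add: k)
  qed
qed

lemma wild_integer_semigroup_eq_iff_primes:
  "wild_integer_semigroup = {of_nat m | m::nat. m > 0 \<and> \<not> 3 dvd m} \<longleftrightarrow>
     (\<forall>p::nat. prime p \<longrightarrow> p \<noteq> 3 \<longrightarrow> of_nat p \<in> wild_semigroup)"
proof
  assume eq: "wild_integer_semigroup = {of_nat m | m::nat. m > 0 \<and> \<not> 3 dvd m}"
  show "\<forall>p::nat. prime p \<longrightarrow> p \<noteq> 3 \<longrightarrow> of_nat p \<in> wild_semigroup"
  proof (intro allI impI)
    fix p :: nat assume "prime p" "p \<noteq> 3"
    then have "p > 0" "\<not> 3 dvd p"
      using primes_dvd_imp_eq[of 3 p] by (auto simp: prime_gt_0_nat)
    then show "of_nat p \<in> wild_semigroup"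
      unfolding of_nat_in_wild_integer_semigroup_iff[symmetric] eq by blast
  qed
next
  assume "\<forall>p::nat. prime p \<longrightarrow> p \<noteq> 3 \<longrightarrow> of_nat p \<in> wild_semigroup"
  then have "of_nat m \<in> wild_semigroup" if "m > 0" "\<not> 3 dvd m" for m :: nat
    using wild_semigroup_of_primes that by blast
  then show "wild_integer_semigroup = {of_nat m | m::nat. m > 0 \<and> \<not> 3 dvd m}"
    using wild_integer_semigroup_subset of_nat_in_wild_integer_semigroup_iff by blast
qed

section \<open>Irreducible elements\<close>

text \<open>Divisors of a number prime to 3 are again prime to 3, so factorizations inside this set
  are the same as among all positive integers.\<close>

lemma irreducibles_in_prime_to_three:
  "irreducibles_in {of_nat m | m::nat. m > 0 \<and> \<not> 3 dvd m} =
     {of_nat p :: rat | p::nat. prime p \<and> p \<noteq> 3}"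
proof -
  let ?S = "{of_nat m :: rat | m::nat. m > 0 \<and> \<not> 3 dvd m}"
  have units: "units_in ?S = {1}"
  proof (intro equalityI subsetI)
    fix u assume "u \<in> units_in ?S"
    then obtain a b :: nat where "u = of_nat a" "of_nat a * of_nat b = (1::rat)"
      by (auto simp: units_in_def)
    then have "of_nat (a * b) = (of_nat 1 :: rat)" by simp
    then have "a * b = 1" by (simp only: of_nat_eq_iff)
    then show "u \<in> {1}" using \<open>u = of_nat a\<close> by simp
  next
    fix u :: rat assume "u \<in> {1}"
    moreover have "(1::rat) \<in> ?S" by (intro CollectI exI[of _ 1]) simp
    ultimately show "u \<in> units_in ?S" by (auto simp: units_in_def)
  qed
  have nonunits: "?S - {1} = {of_nat m | m::nat. m > 1 \<and> \<not> 3 dvd m}"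
  proof (intro equalityI subsetI)
    fix x assume "x \<in> ?S - {1}"
    then obtain m where "x = of_nat m" "m > 0" "\<not> 3 dvd m" "m \<noteq> 1" by auto
    then have "x = of_nat m \<and> m > 1 \<and> \<not> 3 dvd m" by simp
    then show "x \<in> {of_nat m | m::nat. m > 1 \<and> \<not> 3 dvd m}" by blast
  next
    fix x :: rat assume "x \<in> {of_nat m | m::nat. m > 1 \<and> \<not> 3 dvd m}"
    then obtain m where "x = of_nat m" "m > 1" "\<not> 3 dvd m" by blast
    then have "x = of_nat m \<and> m > 0 \<and> \<not> 3 dvd m" "x \<noteq> 1" by auto
    then show "x \<in> ?S - {1}" by blast
  qed
  show ?thesis
  proof (intro equalityI subsetI)
    fix x assume "x \<in> irreducibles_in ?S"
    then have x: "x \<in> ?S - {1}"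
      and irred: "\<not> (\<exists>a \<in> ?S - {1}. \<exists>b \<in> ?S - {1}. x = a * b)"
      unfolding irreducibles_in_def units by blast+
    from x obtain m where m: "x = of_nat m" "m > 1" "\<not> 3 dvd m" unfolding nonunits by blast
    have "prime m"
    proof (rule ccontr)
      assume "\<not> prime m"
      then obtain a where a: "a dvd m" "a \<noteq> 1" "a \<noteq> m"
        using m(2) by (auto simp: prime_nat_iff)
      then obtain b where "m = a * b" by blast
      then have ab: "m = a * b" "1 < a" "1 < b"
        using a m(2) by (cases a; cases b; auto)+
      then have "\<not> 3 dvd a" "\<not> 3 dvd b" using m(3) by auto
      then have "of_nat a \<in> ?S - {1}" "of_nat b \<in> ?S - {1}"
        using ab unfolding nonunits by blast+
      moreover have "x = of_nat a * of_nat b" using ab(1) m(1) by simp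
      ultimately show False using irred by blast
    qed
    then show "x \<in> {of_nat p | p::nat. prime p \<and> p \<noteq> 3}" using m by auto
  next
    fix x :: rat assume "x \<in> {of_nat p | p::nat. prime p \<and> p \<noteq> 3}"
    then obtain p where p: "x = of_nat p" "prime p" "p \<noteq> 3" by blast
    then have "\<not> 3 dvd p" using primes_dvd_imp_eq[of 3 p] by auto
    then have "x \<in> ?S - {1}" using p prime_gt_1_nat unfolding nonunits by blast
    moreover have False if "a \<in> ?S - {1}" "b \<in> ?S - {1}" "x = a * b" for a b
    proof -
      from that obtain k l where "a = of_nat k" "b = of_nat l" "1 < k" "1 < l"
        unfolding nonunits by blast
      with that p have "of_nat p = (of_nat (k * l) :: rat)" by simp
      then have "p = k * l" by (simp only: of_nat_eq_iff)
      then show False using p(2) \<open>1 < k\<close> \<open>1 < l\<close> prime_product[of k l] by auto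
    qed
    ultimately show "x \<in> irreducibles_in ?S"
      unfolding irreducibles_in_def units by blast
  qed
qed

lemma wild_integer_semigroup_eq_iff_wild_numbers:
  "wild_integer_semigroup = {of_nat m | m::nat. m > 0 \<and> \<not> 3 dvd m} \<longleftrightarrow>
     wild_numbers = {of_nat p | p::nat. prime p \<and> p \<noteq> 3}"
proof
  assume eq: "wild_integer_semigroup = {of_nat m | m::nat. m > 0 \<and> \<not> 3 dvd m}"
  show "wild_numbers = {of_nat p | p::nat. prime p \<and> p \<noteq> 3}"
    unfolding wild_numbers_def eq by (rule irreducibles_in_prime_to_three)
next
  assume eq: "wild_numbers = {of_nat p | p::nat. prime p \<and> p \<noteq> 3}"
  \<comment> \<open>Irreducibles are members by definition, so the assumed description puts every
    prime other than 3 into the semigroup, and the criterion by primes applies.\<close>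
  have "wild_numbers \<subseteq> wild_semigroup"
    by (auto simp: wild_numbers_def irreducibles_in_def wild_integer_semigroup_def)
  then show "wild_integer_semigroup = {of_nat m | m::nat. m > 0 \<and> \<not> 3 dvd m}"
    unfolding wild_integer_semigroup_eq_iff_primes eq by blast
qed

section \<open>Consequences of the weak conjecture\<close>

text \<open>The conjecture supplies the reciprocal of the cofactor \<open>k\<close>, and multiplying
  \<open>m\<close> by it leaves \<open>d\<close>.\<close>

lemma divisor_in_wild_semigroup:
  assumes weak_3x_plus_1_conjecture and "d dvd m" "m > 0" "of_nat m \<in> wild_semigroup"
  shows "of_nat d \<in> wild_semigroup"
proof -
  obtain k where k: "m = d * k" using assms(2) by blast
  then have "k > 0" using assms(3) by (auto intro: Nat.gr0I)
  then obtain w where w: "w \<in> wild_semigroup" "of_nat k = inverse w"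
    using assms(1) by (auto simp: weak_3x_plus_1_conjecture_def)
  then have "of_nat d = of_nat m * w"
    \<comment> \<open>As \<open>inverse 0 = 0\<close>, the case \<open>w = 0\<close> would force
      \<open>k = 0\<close>.\<close>
    using k \<open>k > 0\<close> by (cases "w = 0") (simp_all add: field_simps)
  then show ?thesis using assms(4) w(1) by (simp add: wild_semigroup_mult)
qed

text \<open>Multiplication by \<open>g n\<close> performs the accelerated 3x+1 step from
  \<open>N\<close> to \<open>(3 * N + 1) / 2\<close>; doubling and passing to divisors gives the
  claim.\<close>

lemma divisor_of_3N_plus_1_in_wild_semigroup:
  assumes weak_3x_plus_1_conjecture
    and "odd N" "of_nat N \<in> wild_semigroup" "d dvd 3 * N + 1"
  shows "of_nat d \<in> wild_semigroup"
proof -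
  from \<open>odd N\<close> obtain n where n: "N = 2 * n + 1" by (rule oddE)
  have "2 * (g n * of_nat N) \<in> wild_semigroup"
    by (intro wild_semigroup_mult two_in_wild_semigroup g_in_wild_semigroup assms(3))
  moreover have "2 * (g n * of_nat N) = of_nat (3 * N + 1)"
  proof -
    have "(2 * of_nat n + 1 :: rat) \<noteq> 0"
      using of_nat_0_le_iff[of n, where 'a = rat] by linarith
    then show ?thesis by (simp add: n g_def field_simps)
  qed
  ultimately show ?thesis using divisor_in_wild_semigroup[OF assms(1,4)] by simp
qed

text \<open>By Fermat the exponent \<open>p - 2\<close> inverts \<open>p - 6\<close> modulo
  \<open>p\<close>, so the product is congruent to -12 / 36 = -1 / 3. The bound on \<open>p\<close>
  keeps the natural subtractions genuine and \<open>p\<close> prime to 6.\<close>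

lemma prime_dvd_fermat_witness:
  fixes p :: nat
  assumes "prime p" "p \<ge> 13"
  shows "p dvd 3 * ((p - 12) * (p - 6) ^ (2 * (p - 2))) + 1"
proof -
  have "\<not> p dvd 6" using assms(2) by (auto dest: dvd_imp_le)
  then have "[6 ^ (p - 1) = 1] (mod p)" using assms(1) by (intro fermat_theorem)
  \<comment> \<open>Over the integers \<open>p - 12\<close> and \<open>p - 6\<close> can be reduced
    to -12 and -6.\<close>
  then have "[int (6 ^ (p - 1)) = int 1] (mod int p)" by (simp only: cong_int_iff)
  then have "[6 ^ (p - 1) = 1] (mod int p)" by simp
  then have "[(6 ^ (p - 1)) ^ 2 = 1 ^ 2] (mod int p)" by (rule cong_pow)
  then have sq: "[6 ^ (2 * (p - 1)) = 1] (mod int p)" by (simp add: power_mult[symmetric] mult.commute)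
  have "[int p - 12 = - 12] (mod int p)" "[int p - 6 = - 6] (mod int p)"
    by (simp_all add: cong_iff_dvd_diff)
  then have "[3 * ((int p - 12) * (int p - 6) ^ (2 * (p - 2))) + 1
      = 3 * (- 12 * (- 6) ^ (2 * (p - 2))) + 1] (mod int p)"
    by (intro cong_add cong_mult cong_pow cong_refl)
  \<comment> \<open>The exponent is even, so the sign of -6 disappears, and 3 * 12 = 36 supplies the
    two missing factors 6.\<close>
  also have "3 * (- 12 * (- 6) ^ (2 * (p - 2))) + 1 = 1 - (6::int) ^ (2 * (p - 1))"
  proof -
    have "2 * (p - 1) = 2 * (p - 2) + 2" using assms(2) by simp
    then have "(6::int) ^ (2 * (p - 1)) = 36 * 6 ^ (2 * (p - 2))" by (simp only: power_add) simp
    then show ?thesis by simp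
  qed
  also have "[1 - 6 ^ (2 * (p - 1)) = 1 - 1] (mod int p)"
    by (intro cong_diff cong_refl sq)
  finally have "int p dvd 3 * ((int p - 12) * (int p - 6) ^ (2 * (p - 2))) + 1"
    by (simp add: cong_0_iff)
  also have "\<dots> = int (3 * ((p - 12) * (p - 6) ^ (2 * (p - 2))) + 1)"
    using assms(2) by (simp add: of_nat_diff)
  finally show ?thesis by (simp only: of_nat_dvd_iff)
qed

lemma prime_in_wild_semigroup:
  fixes p :: nat
  assumes weak: weak_3x_plus_1_conjecture and "prime p" "p \<noteq> 3"
  shows "of_nat p \<in> wild_semigroup"
  using assms(2,3)
proof (induction p rule: less_induct)
  case (less p)
  \<comment> \<open>\<open>N = 1\<close> yields only divisors of 4, so the chain starts from 5: 3 *
    5 ^ 4 + 1 = 4 * 7 * 67 yields 7, and 3 * 7 + 1 = 2 * 11 yields 11.\<close>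
  have seven: "of_nat 7 \<in> wild_semigroup"
  proof (rule divisor_of_3N_plus_1_in_wild_semigroup[OF weak])
    show "of_nat (5 ^ 4) \<in> wild_semigroup"
      using wild_semigroup_power[OF five_in_wild_semigroup, of 4] by simp
  qed simp_all
  have eleven: "of_nat 11 \<in> wild_semigroup"
    by (rule divisor_of_3N_plus_1_in_wild_semigroup[OF weak _ seven]) simp_all
  show ?case
  proof (cases "p \<ge> 13")
    case True
    have odd: "odd p" using less.prems True by (intro prime_odd_nat) auto
    have three: "\<not> 3 dvd p" using less.prems primes_dvd_imp_eq[of 3 p] by auto
    have smaller: "of_nat m \<in> wild_semigroup" if "m < p" "m > 0" "\<not> 3 dvd m" for m
      by (rule wild_semigroup_of_primes) (use that less.IH in auto)
    \<comment> \<open>Shifting by multiples of 6 preserves the residue modulo 3, needed here, and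
      the parity, needed below.\<close>
    have "of_nat (p - 12) \<in> wild_semigroup" "of_nat (p - 6) \<in> wild_semigroup"
      by (intro smaller; use True three in presburger)+
    then have "of_nat ((p - 12) * (p - 6) ^ (2 * (p - 2))) \<in> wild_semigroup"
      unfolding of_nat_mult of_nat_power by (intro wild_semigroup_mult wild_semigroup_power)
    moreover have "odd ((p - 12) * (p - 6) ^ (2 * (p - 2)))" using odd True by auto
    ultimately show ?thesis
      using divisor_of_3N_plus_1_in_wild_semigroup[OF weak _ _
          prime_dvd_fermat_witness[OF less.prems(1) True]] by simp
  next
    case False
    then have "p \<in> {0,1,2,3,4,5,6,7,8,9,10,11,12}" unfolding insert_iff empty_iff by presburger
    moreover have "\<not> prime (4::nat)" "\<not> prime (6::nat)" "\<not> prime (8::nat)"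
      "\<not> prime (9::nat)" "\<not> prime (10::nat)" "\<not> prime (12::nat)" by simp_all
    ultimately have "p \<in> {2,5,7,11}" using less.prems by auto
    then show ?thesis
      using two_in_wild_semigroup five_in_wild_semigroup seven eleven by auto
  qed
qed

theorem theorem3p3:
  shows "(weak_3x_plus_1_conjecture \<longrightarrow>
            wild_integer_semigroup = {of_nat m | m::nat. m > 0 \<and> \<not> 3 dvd m} \<and>
            wild_numbers = {of_nat p | p::nat. prime p \<and> p \<noteq> 3}) \<and>
         (wild_integer_semigroup = {of_nat m | m::nat. m > 0 \<and> \<not> 3 dvd m} \<longleftrightarrow>
            wild_numbers = {of_nat p | p::nat. prime p \<and> p \<noteq> 3})"
proof -
  have "wild_integer_semigroup = {of_nat m | m::nat. m > 0 \<and> \<not> 3 dvd m}"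
    if weak_3x_plus_1_conjecture
    unfolding wild_integer_semigroup_eq_iff_primes using prime_in_wild_semigroup[OF that] by blast
  then show ?thesis
    using wild_integer_semigroup_eq_iff_wild_numbers by blast
qed

end
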